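(* As $L \to 0$, $$C_*(L) = C_H(L) + O(L^4).$$
   Context: The real variable $L$ stands for the quantity $L_f(x) = f(x)f''(x)/f'(x)^2$, regarded as ranging over $\mathbb{R}$. The correction function $C_*$ of the proposed iterative method is defined for $L \in \mathbb{R}$ by $$C_*(L) = \frac{2}{1 + B(L)}, \qquad B(L) = \frac{1 - L + \frac{1}{2}L^2}{1 - L + L^2}\left(\sqrt{1 + L^2} - L\right).$$ Halley's correction function is $$C_H(L) = \frac{2}{2 - L}, \qquad L \neq 2.$$ *)

theory Defs
  imports Complex_Main "HOL-Library.Landau_Symbols"
begin

text \<open>
  All definitions are functions of a real variable \<open>L\<close>. Both \<open>1 - L + L^2\<close> and
  \<open>B_corr L\<close> are positive for every real \<open>L\<close>, so no division by zero occurs in \<open>B_corr\<close>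
  or \<open>C_star\<close>.
\<close>

definition B_corr :: "real \<Rightarrow> real" where
  "B_corr L = (1 - L + 1 / 2 * L^2) / (1 - L + L^2) * (sqrt (1 + L^2) - L)"

definition C_star :: "real \<Rightarrow> real" where
  "C_star L = 2 / (1 + B_corr L)"

text \<open>Halley's correction function is meaningful only for \<open>L \<noteq> 2\<close>; at \<open>L = 2\<close> the
  definition below takes the conventional value \<open>0\<close> of division by zero.\<close>

definition C_Halley :: "real \<Rightarrow> real" where
  "C_Halley L = 2 / (2 - L)"

end

theory Submission
  imports Defs "HOL-Real_Asymp.Real_Asymp"
begin

theorem proposition3p3:
  shows "(\<lambda>L::real. C_star L - C_Halley L) \<in> O[at 0](\<lambda>L. L ^ 4)"
  \<comment> \<open>Near 0 the rational factor of \<open>B_corr L\<close> is 1 - L^2/2 - L^3/2 +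
    O(L^5) and the other factor is 1 - L + L^2/2 + O(L^4). In the product the L^2 and L^3 terms
    cancel, leaving 1 - L + L^4/8 + O(L^5). So 1 + \<open>B_corr L\<close> agrees with 2 - L up to
    O(L^4); both tend to 2, hence the quotients also differ by O(L^4), with leading term
    -L^4/16.\<close>
  unfolding C_star_def C_Halley_def B_corr_def by real_asymp

end
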